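(* For every positive integer $t$, there is a tournament $T_t$ on $\bigl(2(t+1)^2\bigr)^t$ vertices that is realized by $4t+1$ linear orders and has property $S_t$. In particular, $T_t$ is a $(2t+1)$-majority tournament and $\gamma(T_t)\ge t+1$.
   Context: A tournament $T=(V,E)$ is a finite directed graph without loops such that for every two distinct vertices $u,v$ exactly one of $uv,vu$ is an arc; write $u\to v$ when $uv\in E$. For a vertex $x$ and $U\subseteq V$, $x\to U$ means $x\to y$ for every $y\in U\setminus\{x\}$. A set $D\subseteq V$ is a dominating set if for every $y\in V\setminus D$ there is $x\in D$ with $x\to y$; $\gamma(T)$ denotes the minimum size of a dominating set of $T$. Linear orders $P_1,\ldots,P_{2k-1}$ on a finite set $V$ (where $k$ is a positive integer) realize the tournament on $V$ in which, for distinct $u,v\in V$, $u\to v$ if and only if $u$ lies above $v$ in at least $k$ of the orders. A tournament realizable in this way by $2k-1$ linear orders is called a $k$-majority tournament. (Thus being realized by $4t+1=2(2t+1)-1$ linear orders refers to the threshold $k=2t+1$.) A tournament with vertex set $V$ has property $S_t$ if for every $t$-element set $U\subseteq V$ there is a vertex $x\in V\setminus U$ such that $x\to U$. *)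

theory Defs
  imports "Graph_Theory.Pair_Digraph"
begin

locale tournament = pair_digraph G for G :: "'a pair_pre_digraph" +
  assumes exactly_one_arc:
    "\<And>u v. u \<in> pverts G \<Longrightarrow> v \<in> pverts G \<Longrightarrow> u \<noteq> v \<Longrightarrow>
      (u, v) \<in> parcs G \<longleftrightarrow> (v, u) \<notin> parcs G"

definition dominates_set :: "'a pair_pre_digraph \<Rightarrow> 'a \<Rightarrow> 'a set \<Rightarrow> bool" where
  "dominates_set T x U \<longleftrightarrow> (\<forall>y \<in> U - {x}. (x, y) \<in> parcs T)"

definition dominating_set :: "'a pair_pre_digraph \<Rightarrow> 'a set \<Rightarrow> bool" where
  "dominating_set T D \<longleftrightarrow>
     D \<subseteq> pverts T \<and> (\<forall>y \<in> pverts T - D. \<exists>x \<in> D. (x, y) \<in> parcs T)"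

text \<open>Meaningful when the vertex set is finite, since \<^const>\<open>card\<close> is 0 on infinite sets.\<close>

definition domination_number :: "'a pair_pre_digraph \<Rightarrow> nat" where
  "domination_number T = (LEAST n. \<exists>D. dominating_set T D \<and> card D = n)"

text \<open>
  A linear order \<open>P\<close> is a reflexive relation in the sense of \<^const>\<open>linear_order_on\<close>;
  \<open>(v, u) \<in> P\<close> is read \<open>v \<le> u\<close>, so for \<open>u \<noteq> v\<close> it says that \<open>u\<close> lies above \<open>v\<close>.
  The orders form a list because the same order may be used several times.
\<close>

definition majority_digraph :: "nat \<Rightarrow> 'a rel list \<Rightarrow> 'a set \<Rightarrow> 'a pair_pre_digraph" where
  "majority_digraph k Ps V =
     \<lparr>pverts = V,
      parcs = {(u, v). u \<in> V \<and> v \<in> V \<and> u \<noteq> v \<and>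
                       k \<le> length (filter (\<lambda>P. (v, u) \<in> P) Ps)}\<rparr>"

definition realizes :: "nat \<Rightarrow> 'a rel list \<Rightarrow> 'a pair_pre_digraph \<Rightarrow> bool" where
  "realizes k Ps T \<longleftrightarrow>
     0 < k \<and> length Ps = 2 * k - 1 \<and> finite (pverts T) \<and>
     (\<forall>P \<in> set Ps. linear_order_on (pverts T) P) \<and>
     T = majority_digraph k Ps (pverts T)"

definition majority_tournament :: "nat \<Rightarrow> 'a pair_pre_digraph \<Rightarrow> bool" where
  "majority_tournament k T \<longleftrightarrow> tournament T \<and> (\<exists>Ps. realizes k Ps T)"

definition property_S :: "nat \<Rightarrow> 'a pair_pre_digraph \<Rightarrow> bool" where
  "property_S t T \<longleftrightarrow>
     (\<forall>U. U \<subseteq> pverts T \<and> card U = t \<longrightarrow> (\<exists>x \<in> pverts T - U. dominates_set T x U))"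

lemma tournament_majority_digraph:
  assumes "0 < k" "length Ps = 2 * k - 1" "finite V"
    and "\<forall>P \<in> set Ps. linear_order_on V P"
  shows "tournament (majority_digraph k Ps V)" (is "tournament ?T")
proof -
  have verts: "pverts ?T = V"
    by (simp add: majority_digraph_def)
  have arcs: "parcs ?T = {(u, v). u \<in> V \<and> v \<in> V \<and> u \<noteq> v \<and>
      k \<le> length (filter (\<lambda>P. (v, u) \<in> P) Ps)}"
    by (simp add: majority_digraph_def)
  have sub: "parcs ?T \<subseteq> V \<times> V"
    by (auto simp: arcs)
  have fin: "finite (parcs ?T)"
    using finite_subset[OF sub] assms(3) by simp
  have one: "(u, v) \<in> parcs ?T \<longleftrightarrow> (v, u) \<notin> parcs ?T"
    if uv: "u \<in> V" "v \<in> V" "u \<noteq> v" for u v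
  proof -
    have "(u, v) \<in> P \<longleftrightarrow> (v, u) \<notin> P" if "P \<in> set Ps" for P
      using assms(4) that uv
      unfolding linear_order_on_def partial_order_on_def total_on_def antisym_def by metis
    then have "filter (\<lambda>P. (u, v) \<in> P) Ps = filter (\<lambda>P. (v, u) \<notin> P) Ps"
      by (intro filter_cong) auto
    then have "length (filter (\<lambda>P. (v, u) \<in> P) Ps) +
        length (filter (\<lambda>P. (u, v) \<in> P) Ps) = 2 * k - 1"
      using sum_length_filter_compl[of "\<lambda>P. (v, u) \<in> P" Ps] assms by simp
    then show ?thesis
      using uv assms(1) by (auto simp: arcs)
  qed
  show ?thesis
  proof
    show "fst e \<in> pverts ?T" "snd e \<in> pverts ?T" if "e \<in> parcs ?T" for e
      using subsetD[OF sub that] unfolding verts by (auto simp: mem_Times_iff)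
    show "fst e \<noteq> snd e" if "e \<in> parcs ?T" for e
      using that unfolding arcs by auto
    show "finite (pverts ?T)"
      using assms(3) unfolding verts .
    show "finite (parcs ?T)"
      by (fact fin)
    show "(u, v) \<in> parcs ?T \<longleftrightarrow> (v, u) \<notin> parcs ?T"
      if "u \<in> pverts ?T" "v \<in> pverts ?T" "u \<noteq> v" for u v
      using that one unfolding verts by blast
  qed
qed

lemma realizes_imp_tournament: "realizes k Ps T \<Longrightarrow> tournament T"
  unfolding realizes_def by (metis tournament_majority_digraph)

end

theory Submission
  imports Defs "HOL-Library.FuncSet" "HOL-Library.Product_Lexorder"
begin

text \<open>
  Vertices are words of length \<open>t\<close> over the alphabet of triples \<open>(h, r, c)\<close>, a half \<open>h\<close> and a
  position \<open>(r, c)\<close> in a \<open>(t + 1) \<times> (t + 1)\<close> grid. Each coordinate contributes four linear orders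
  that split \<open>2 : 2\<close> on most pairs of words, so that coordinates hardly interfere: a word that
  never gets fewer than two of the four orders of a coordinate, and gets three of them in one
  coordinate, has \<open>2 * t + 1\<close> orders and wins, whatever the one remaining order says.

  The four orders come as two pairs. In a pair, words are grouped into lanes; the second order
  reverses the sequence of lanes, so words from different lanes split \<open>1 : 1\<close>, while
  within a lane both orders put the same one of the two halves on top. The first pair uses
  rows as lanes and puts \<open>True\<close> on top, the second uses columns and puts \<open>False\<close> on top. Hence
  \<open>(False, r, c)\<close> is beaten exactly by \<open>(True, r, c')\<close> with \<open>c' \<noteq> c\<close>, and \<open>(True, r, c')\<close> in turn only
  by letters of column \<open>c'\<close> (relation \<open>beats\<close>). Among any \<open>t\<close> letters, each letter \<open>b\<close> is
  therefore beaten by one that none of them beats: leave the half of \<open>b\<close>, and move to a column (or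
  row) that the \<open>t\<close> letters miss, which exists because there are \<open>t + 1\<close> of them
  (lemma \<open>ex_unbeaten_beating\<close>).

  To dominate words \<open>u\<^sub>0, \<dots>, u\<^sub>t\<^sub>-\<^sub>1\<close>, choose for coordinate \<open>j\<close> a letter that beats the \<open>j\<close>-th letter
  of \<open>u\<^sub>j\<close> and is beaten by the \<open>j\<close>-th letter of no \<open>u\<^sub>i\<close>.
\<close>

section \<open>Property S and the domination number\<close>

text \<open>
  A dominating set of at most \<open>t\<close> vertices could be enlarged to \<open>t\<close> vertices, all of them
  beaten by one outside vertex, which then no vertex of the set dominates.
\<close>

lemma property_S_imp_domination_number:
  assumes T: "tournament T" and S: "property_S t T" and t: "t \<le> card (pverts T)"
  shows "t + 1 \<le> domination_number T"
proof -
  interpret tournament T by fact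
  have "t + 1 \<le> card D" if D: "dominating_set T D" for D
  proof (rule ccontr)
    assume "\<not> t + 1 \<le> card D"
    moreover have sub: "D \<subseteq> pverts T"
      using D by (simp add: dominating_set_def)
    ultimately obtain U where U: "D \<subseteq> U" "U \<subseteq> pverts T" "card U = t"
      using exists_subset_between[of D t "pverts T"] t by auto
    then obtain x where x: "x \<in> pverts T - U" "dominates_set T x U"
      using S unfolding property_S_def by blast
    then obtain y where y: "y \<in> D" "(y, x) \<in> parcs T"
      using D U unfolding dominating_set_def by blast
    then have "(x, y) \<in> parcs T"
      using x U unfolding dominates_set_def by blast
    then show False
      using y x U exactly_one_arc[of x y] by blast
  qed
  moreover have "dominating_set T (pverts T)"
    by (simp add: dominating_set_def)
  then have "\<exists>D. dominating_set T D \<and> card D = domination_number T"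
    unfolding domination_number_def
    using LeastI_ex[of "\<lambda>n. \<exists>D. dominating_set T D \<and> card D = n"] by blast
  ultimately show ?thesis
    by metis
qed

section \<open>Linear orders from keys\<close>

definition order_by :: "('a \<Rightarrow> 'b::linorder) \<Rightarrow> 'a set \<Rightarrow> 'a rel" where
  "order_by f V = {(v, u). v \<in> V \<and> u \<in> V \<and> f v \<le> f u}"

lemma linear_order_on_order_by:
  assumes "inj_on f V"
  shows "linear_order_on V (order_by f V)"
  using assms
  unfolding linear_order_on_def partial_order_on_def preorder_on_def refl_on_def
    total_on_def antisym_def trans_def order_by_def inj_on_def
  by auto

text \<open>
  The final component of the keys makes them injective; its opposite signs let words that agree in
  lane and level split \<open>1 : 1\<close>.
\<close>

definition lane_orders :: "nat set \<Rightarrow> (nat \<Rightarrow> nat) \<Rightarrow> (nat \<Rightarrow> bool) \<Rightarrow> nat rel list" where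
  "lane_orders V lane level =
     [order_by (\<lambda>v. (int (lane v), level v, int v)) V,
      order_by (\<lambda>v. (- int (lane v), level v, - int v)) V]"

lemma linear_order_on_lane_orders:
  "P \<in> set (lane_orders V lane level) \<Longrightarrow> linear_order_on V P"
  by (auto simp: lane_orders_def inj_on_def intro!: linear_order_on_order_by)

abbreviation votes :: "'a rel list \<Rightarrow> 'a \<Rightarrow> 'a \<Rightarrow> nat" where
  "votes Ps x u \<equiv> length (filter (\<lambda>P. (u, x) \<in> P) Ps)"

lemma votes_lane_orders_ge:
  assumes "x \<in> V" "u \<in> V"
  shows "(if lane x = lane u \<and> level x < level u then 0
          else if lane x = lane u \<and> level u < level x then 2 else 1)
         \<le> votes (lane_orders V lane level) x u"
  using assms by (auto simp: lane_orders_def order_by_def less_eq_prod_def)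

section \<open>The alphabet\<close>

type_synonym letter = "bool \<times> nat \<times> nat"

definition letters :: "nat \<Rightarrow> letter set" where
  "letters t = UNIV \<times> {..t} \<times> {..t}"

fun beats :: "letter \<Rightarrow> letter \<Rightarrow> bool" where
  "beats (h, r, c) (h', r', c') \<longleftrightarrow>
     h \<and> \<not> h' \<and> r = r' \<and> c \<noteq> c' \<or> \<not> h \<and> h' \<and> c = c' \<and> r \<noteq> r'"

lemma finite_letters: "finite (letters t)"
  by (simp add: letters_def)

lemma card_letters: "card (letters t) = 2 * (t + 1)^2"
  by (simp add: letters_def card_cartesian_product power2_eq_square)

text \<open>
  A letter of the half \<open>True\<close> is beaten only from its own column, and one of the half \<open>False\<close> only
  from its own row; so a column or row disjoint from \<open>B\<close> is safe. It also differs from that of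
  \<open>b\<close>, since \<open>b \<in> B\<close>, as needed for beating \<open>b\<close>.
\<close>

lemma ex_unbeaten_beating:
  assumes "finite B" "card B \<le> t" "b \<in> B" "b \<in> letters t"
  obtains x where "x \<in> letters t" "beats x b" "\<forall>b' \<in> B. \<not> beats b' x"
proof -
  obtain h r c where b: "b = (h, r, c)"
    by (cases b)
  have unused: "\<exists>k \<le> t. \<forall>b' \<in> B. f b' \<noteq> k" for f :: "letter \<Rightarrow> nat"
  proof (rule ccontr)
    assume "\<not> ?thesis"
    then have "{..t} \<subseteq> f ` B"
      by blast
    then have "t + 1 \<le> card (f ` B)"
      using card_mono[of "f ` B" "{..t}"] assms by simp
    then show False
      using card_image_le[of B f] assms by simp
  qed
  show ?thesis
  proof (cases h)
    case True
    obtain r' where "r' \<le> t" "\<And>h c. (h, r', c) \<notin> B"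
      using unused[of "fst \<circ> snd"] by force
    then have "(False, r', c) \<in> letters t" "beats (False, r', c) b"
      "\<forall>b' \<in> B. \<not> beats b' (False, r', c)"
      using True assms(3,4) b by (auto simp: letters_def)
    then show ?thesis
      by (rule that)
  next
    case False
    obtain c' where "c' \<le> t" "\<And>h r. (h, r, c') \<notin> B"
      using unused[of "snd \<circ> snd"] by force
    then have "(True, r, c') \<in> letters t" "beats (True, r, c') b"
      "\<forall>b' \<in> B. \<not> beats b' (True, r, c')"
      using False assms(3,4) b by (auto simp: letters_def)
    then show ?thesis
      by (rule that)
  qed
qed

section \<open>The orders on words\<close>

text \<open>
  Words are coded by natural numbers: \<open>w v i\<close> is the \<open>i\<close>-th letter of the word with code \<open>v\<close>.
\<close>

definition letter_orders :: "nat set \<Rightarrow> (nat \<Rightarrow> letter) \<Rightarrow> nat rel list" where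
  "letter_orders V l =
     lane_orders V (fst \<circ> snd \<circ> l) (fst \<circ> l) @
     lane_orders V (snd \<circ> snd \<circ> l) (Not \<circ> fst \<circ> l)"

text \<open>The order by \<open>id\<close> is arbitrary and only makes the number of orders odd.\<close>

definition word_orders :: "nat \<Rightarrow> nat set \<Rightarrow> (nat \<Rightarrow> nat \<Rightarrow> letter) \<Rightarrow> nat rel list" where
  "word_orders t V w =
     order_by id V # concat (map (\<lambda>i. letter_orders V (\<lambda>v. w v i)) [0..<t])"

lemma votes_letter_orders_ge:
  assumes "x \<in> V" "u \<in> V" "\<not> beats (l u) (l x)"
  shows "(if beats (l x) (l u) then 3 else 2) \<le> votes (letter_orders V l) x u"
proof -
  obtain h r c h' r' c' where eqs: "l x = (h, r, c)" "l u = (h', r', c')"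
    by (metis prod_cases3)
  show ?thesis
    using assms(3) eqs
      votes_lane_orders_ge[OF assms(1,2), of "fst \<circ> snd \<circ> l" "fst \<circ> l"]
      votes_lane_orders_ge[OF assms(1,2), of "snd \<circ> snd \<circ> l" "Not \<circ> fst \<circ> l"]
    by (cases h; cases h'; cases "r = r'"; cases "c = c'") (simp_all add: letter_orders_def)
qed

lemma length_word_orders: "length (word_orders t V w) = 4 * t + 1"
  by (simp add: word_orders_def letter_orders_def lane_orders_def length_concat comp_def
      sum_list_triv)

lemma linear_order_on_word_orders:
  "P \<in> set (word_orders t V w) \<Longrightarrow> linear_order_on V P"
  by (auto simp: word_orders_def letter_orders_def
      intro: linear_order_on_lane_orders linear_order_on_order_by)

lemma votes_word_orders_ge:
  assumes "x \<in> V" "u \<in> V"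
    and unbeaten: "\<And>i. i < t \<Longrightarrow> \<not> beats (w u i) (w x i)"
    and j: "j < t" "beats (w x j) (w u j)"
  shows "2 * t + 1 \<le> votes (word_orders t V w) x u"
proof -
  let ?n = "\<lambda>i. votes (letter_orders V (\<lambda>v. w v i)) x u"
  have n: "(if beats (w x i) (w u i) then 3 else 2) \<le> ?n i" if "i < t" for i
    using votes_letter_orders_ge[OF assms(1,2), of "\<lambda>v. w v i"] unbeaten[OF that] by simp
  have "2 * t + 1 = (\<Sum>i<t. 2) + 1"
    by simp
  also have "\<dots> \<le> (\<Sum>i<t. ?n i)"
  proof -
    have "(\<Sum>i<t. 2) < (\<Sum>i<t. ?n i)"
    proof (rule sum_strict_mono_ex1)
      show "\<forall>i \<in> {..<t}. 2 \<le> ?n i"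
        using n by (force split: if_splits)
      show "\<exists>i \<in> {..<t}. 2 < ?n i"
        using n[OF j(1)] j by (intro bexI[of _ j]) auto
    qed simp
    then show ?thesis
      by simp
  qed
  also have "\<dots> = sum_list (map ?n [0..<t])"
    by (simp add: interv_sum_list_conv_sum_set_nat atLeast0LessThan)
  also have "\<dots> \<le> votes (word_orders t V w) x u"
    by (simp add: word_orders_def filter_concat length_concat comp_def)
  finally show ?thesis .
qed

text \<open>
  That every sequence of letters is spelled by a vertex makes the choices in the coordinates
  independent of each other.
\<close>

lemma property_S_word_orders:
  assumes letters: "\<And>v i. v \<in> V \<Longrightarrow> i < t \<Longrightarrow> w v i \<in> letters t"
    and all_words: "\<And>a. \<forall>i<t. a i \<in> letters t \<Longrightarrow> \<exists>v \<in> V. \<forall>i<t. w v i = a i"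
    and "0 < t"
  shows "property_S t (majority_digraph (2 * t + 1) (word_orders t V w) V)"
    (is "property_S t ?T")
  unfolding property_S_def
proof (intro allI impI)
  fix U
  assume "U \<subseteq> pverts ?T \<and> card U = t"
  then have U: "U \<subseteq> V" "card U = t"
    by (auto simp: majority_digraph_def)
  then have fin: "finite U"
    using \<open>0 < t\<close> card_ge_0_finite by blast
  obtain u where u: "bij_betw u {0..<t} U"
    using ex_bij_betw_nat_finite[OF fin] U by auto
  have "\<exists>a. a \<in> letters t \<and> beats a (w (u j) j) \<and> (\<forall>v \<in> U. \<not> beats (w v j) a)"
    if j: "j < t" for j
  proof -
    have u_j: "u j \<in> U"
      using u j by (auto simp: bij_betw_def)
    let ?B = "(\<lambda>v. w v j) ` U"
    have "finite ?B" "card ?B \<le> t" "w (u j) j \<in> ?B" "w (u j) j \<in> letters t"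
      using fin card_image_le[OF fin] U u_j letters[OF _ j] by auto
    then obtain b where "b \<in> letters t" "beats b (w (u j) j)" "\<forall>b' \<in> ?B. \<not> beats b' b"
      by (rule ex_unbeaten_beating)
    then show ?thesis
      by blast
  qed
  then obtain a where a: "a j \<in> letters t" "beats (a j) (w (u j) j)"
    "\<forall>v \<in> U. \<not> beats (w v j) (a j)" if "j < t" for j
    by metis
  obtain x where x: "x \<in> V" "\<And>i. i < t \<Longrightarrow> w x i = a i"
    using all_words[of a] a by blast
  have wins: "x \<noteq> v \<and> (x, v) \<in> parcs ?T" if v: "v \<in> U" for v
  proof -
    obtain j where j: "j < t" "u j = v"
      using u v by (auto simp: bij_betw_def)
    have beats: "beats (w x j) (w v j)" "\<not> beats (w v j) (w x j)"
      using a[OF j(1)] x j v by auto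
    then have "x \<noteq> v"
      by auto
    moreover have "2 * t + 1 \<le> votes (word_orders t V w) x v"
      using v U x a j beats by (intro votes_word_orders_ge[of _ _ _ _ _ j]) auto
    ultimately show ?thesis
      using v U x by (auto simp: majority_digraph_def)
  qed
  then have "x \<in> pverts ?T - U"
    using x by (auto simp: majority_digraph_def)
  moreover have "dominates_set ?T x U"
    using wins by (auto simp: dominates_set_def)
  ultimately show "\<exists>x \<in> pverts ?T - U. dominates_set ?T x U" ..
qed

section \<open>The tournament\<close>

theorem theorem1:
  fixes t :: nat
  assumes "0 < t"
  shows "\<exists>T :: nat pair_pre_digraph.
           tournament T \<and>
           card (pverts T) = (2 * (t + 1)^2)^t \<and>
           (\<exists>Ps. length Ps = 4 * t + 1 \<and> realizes (2 * t + 1) Ps T) \<and>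
           property_S t T \<and>
           majority_tournament (2 * t + 1) T \<and>
           domination_number T \<ge> t + 1"
proof -
  define N where "N = (2 * (t + 1)^2)^t"
  define V where "V = {0..<N}"
  let ?W = "{0..<t} \<rightarrow>\<^sub>E letters t"
  have "finite ?W" "card ?W = N"
    by (simp_all add: finite_PiE finite_letters card_PiE card_letters N_def)
  then obtain w where w: "bij_betw w V ?W"
    unfolding V_def using ex_bij_betw_nat_finite by metis
  define Ps where "Ps = word_orders t V w"
  define T where "T = majority_digraph (2 * t + 1) Ps V"
  have verts: "pverts T = V"
    by (simp add: T_def majority_digraph_def)
  have length: "length Ps = 4 * t + 1"
    by (simp add: Ps_def length_word_orders)
  have real: "realizes (2 * t + 1) Ps T"
    using length verts
    by (auto simp: realizes_def Ps_def T_def V_def intro: linear_order_on_word_orders)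
  then have tour: "tournament T"
    by (rule realizes_imp_tournament)
  have S: "property_S t T"
    unfolding T_def Ps_def
  proof (rule property_S_word_orders[OF _ _ assms])
    show "w v i \<in> letters t" if "v \<in> V" "i < t" for v i
      using bij_betwE[OF w] that by (auto simp: PiE_iff)
    show "\<exists>v \<in> V. \<forall>i<t. w v i = a i" if "\<forall>i<t. a i \<in> letters t" for a
    proof -
      have "restrict a {0..<t} \<in> w ` V"
        using that bij_betw_imp_surj_on[OF w] by (simp add: restrict_PiE_iff)
      then obtain v where "v \<in> V" "w v = restrict a {0..<t}"
        by auto
      then show ?thesis
        by (intro bexI[of _ v]) auto
    qed
  qed
  have "t \<le> 2 ^ t"
    using less_exp[of t] by simp
  also have "\<dots> \<le> N"
    unfolding N_def by (rule power_mono) simp_all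
  finally have "t \<le> card (pverts T)"
    by (simp add: verts V_def)
  then have "t + 1 \<le> domination_number T"
    by (rule property_S_imp_domination_number[OF tour S])
  moreover have "card (pverts T) = (2 * (t + 1)^2)^t"
    by (simp add: verts V_def N_def)
  ultimately show ?thesis
    using tour length real S unfolding majority_tournament_def by blast
qed

end
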